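(* Let $b\ge 2$ be an integer, and let $S_n(x,y)$ be the length of the longest common substring with shifts of $x$ and $y$ in the first $n$ digits of their $b$-ary expansions. For every $0<\alpha<\infty$, the set $$S(\alpha)=\Big\{(x,y)\in(0,1]\times(0,1]:\ \lim_{n\to\infty}\frac{S_n(x,y)}{\log_b n}=\alpha\Big\}$$ is of the first category in $(0,1]\times(0,1]$. Moreover, the set $$S(0,\infty)=\Big\{(x,y)\in(0,1]\times(0,1]:\ \liminf_{n\to\infty}\frac{S_n(x,y)}{\log_b n}=0,\ \limsup_{n\to\infty}\frac{S_n(x,y)}{\log_b n}=\infty\Big\}$$ is residual in $(0,1]\times(0,1]$.
   Context: Fix an integer $b\ge2$ and let $\mathcal A=\{0,1,\dots,b-1\}$. Every $x\in(0,1]$ has a unique non-terminating $b$-ary expansion $x=\sum_{i=1}^\infty x_i b^{-i}$ with $x_i\in\mathcal A$ (non-terminating: infinitely many $x_i$ are nonzero); $(x_1,x_2,\dots)$ is the digit sequence of $x$. Write $x_{i+1}^{i+l}=(x_{i+1},\dots,x_{i+l})$. For $(x,y)\in(0,1]^2$ and an integer $n\ge1$, $$S_n(x,y)=\max\{l\ge1:\ x_{i+1}^{i+l}=y_{j+1}^{j+l}\ \text{for some}\ 0\le i,j\le n-l\},$$ with $S_n(x,y)=0$ if no such $l$ exists. The space $(0,1]^2$ carries the usual (Euclidean subspace) topology. A set is of the first category if it is a countable union of nowhere dense sets; it is residual if its complement is of the first category. *)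

theory Defs
  imports "HOL-Analysis.Analysis"
begin

text \<open>
  Digit sequences are indexed from \<open>0\<close>: \<open>d i\<close> is the coefficient of \<open>1 / b ^ (i + 1)\<close>,
  written \<open>x\<^sub>i\<^sub>+\<^sub>1\<close> in the usual notation.
\<close>

definition is_nonterminating_expansion :: "nat \<Rightarrow> real \<Rightarrow> (nat \<Rightarrow> nat) \<Rightarrow> bool" where
  "is_nonterminating_expansion b x d \<longleftrightarrow>
     (\<forall>i. d i < b) \<and> infinite {i. d i \<noteq> 0} \<and>
     (\<lambda>i. real (d i) / real b ^ (i + 1)) sums x"

definition digits :: "nat \<Rightarrow> real \<Rightarrow> nat \<Rightarrow> nat" where
  "digits b x = (THE d. is_nonterminating_expansion b x d)"

text \<open>
  The block \<open>x\<^sub>i\<^sub>+\<^sub>1, \<dots>, x\<^sub>i\<^sub>+\<^sub>l\<close> is \<open>digits b x (i + k)\<close> for \<open>k < l\<close>. The bounds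
  \<open>i, j \<le> n - l\<close> are written additively because subtraction on \<^typ>\<open>nat\<close> truncates.
\<close>

definition common_substring_lengths :: "nat \<Rightarrow> nat \<Rightarrow> real \<Rightarrow> real \<Rightarrow> nat set" where
  "common_substring_lengths b n x y =
     {l. 1 \<le> l \<and> (\<exists>i j. i + l \<le> n \<and> j + l \<le> n \<and>
            (\<forall>k<l. digits b x (i + k) = digits b y (j + k)))}"

definition longest_common_substring :: "nat \<Rightarrow> nat \<Rightarrow> real \<Rightarrow> real \<Rightarrow> nat" where
  "longest_common_substring b n x y =
     (if common_substring_lengths b n x y = {} then 0
      else Max (common_substring_lengths b n x y))"

definition nowhere_dense_in :: "'a topology \<Rightarrow> 'a set \<Rightarrow> bool" where
  "nowhere_dense_in X A \<longleftrightarrow> A \<subseteq> topspace X \<and> X interior_of (X closure_of A) = {}"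

definition first_category_in :: "'a topology \<Rightarrow> 'a set \<Rightarrow> bool" where
  "first_category_in X A \<longleftrightarrow>
     (\<exists>\<F>. countable \<F> \<and> (\<forall>N\<in>\<F>. nowhere_dense_in X N) \<and> A = \<Union>\<F>)"

definition residual_in :: "'a topology \<Rightarrow> 'a set \<Rightarrow> bool" where
  "residual_in X A \<longleftrightarrow> A \<subseteq> topspace X \<and> first_category_in X (topspace X - A)"

text \<open>The definite description in \<^const>\<open>digits\<close> and the maximum above are well defined.\<close>

lemma finite_common_substring_lengths: "finite (common_substring_lengths b n x y)"
  by (rule finite_subset[of _ "{..n}"]) (auto simp: common_substring_lengths_def)

fun digit_prefix :: "nat \<Rightarrow> (nat \<Rightarrow> nat) \<Rightarrow> nat \<Rightarrow> nat" where
  "digit_prefix b d 0 = 0"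
| "digit_prefix b d (Suc n) = b * digit_prefix b d n + d n"

lemma sum_digits_eq_prefix:
  assumes "b \<ge> 2"
  shows "(\<Sum>i<n. real (d i) / real b ^ (i + 1)) = real (digit_prefix b d n) / real b ^ n"
  using assms by (induction n) (auto simp: field_simps)

lemma digit_prefix_eq_ceiling:
  assumes b: "b \<ge> 2" and d: "is_nonterminating_expansion b x d"
  shows "int (digit_prefix b d n) = \<lceil>real b ^ n * x\<rceil> - 1"
proof -
  define f where "f = (\<lambda>i. real (d i) / real b ^ (i + 1))"
  have lt: "\<And>i. d i < b" and inf: "infinite {i. d i \<noteq> 0}" and sm: "f sums x"
    using d by (auto simp: is_nonterminating_expansion_def f_def)
  have "(\<lambda>i. f (i + n)) sums (x - (\<Sum>i<n. f i))"
    using sm by (rule sums_split_initial_segment)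
  then have tail: "(\<lambda>i. f (i + n)) sums (x - real (digit_prefix b d n) / real b ^ n)"
    using sum_digits_eq_prefix[OF b, of d n] by (simp add: f_def)
  obtain m where m: "m \<ge> n" "d m \<noteq> 0"
    using inf by (metis (mono_tags, lifting) infinite_nat_iff_unbounded_le mem_Collect_eq)
  have "0 < f ((m - n) + n)" using m b by (simp add: f_def)
  moreover have "\<And>i. 0 \<le> f (i + n)" by (simp add: f_def)
  ultimately have "0 < (\<Sum>i. f (i + n))"
    using suminf_pos2[of "\<lambda>i. f (i + n)" "m - n"] tail sums_summable by blast
  then have pos: "0 < x - real (digit_prefix b d n) / real b ^ n"
    using tail sums_unique by metis
  have "(\<lambda>i. (1 / real b) ^ i) sums (1 / (1 - 1 / real b))"
    using b by (intro geometric_sums) auto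
  then have "(\<lambda>i. (real b - 1) / real b ^ (n + 1) * (1 / real b) ^ i) sums
      ((real b - 1) / real b ^ (n + 1) * (1 / (1 - 1 / real b)))"
    by (rule sums_mult)
  moreover have "(real b - 1) / real b ^ (n + 1) * (1 / (1 - 1 / real b)) = 1 / real b ^ n"
    using b by (simp add: field_simps)
  ultimately have geo:
    "(\<lambda>i. (real b - 1) / real b ^ (n + 1) * (1 / real b) ^ i) sums (1 / real b ^ n)"
    by metis
  have "f (i + n) \<le> (real b - 1) / real b ^ (n + 1) * (1 / real b) ^ i" for i
  proof -
    have "real (d (i + n)) \<le> real b - 1" using lt[of "i + n"] by linarith
    then have "f (i + n) \<le> (real b - 1) / real b ^ (i + n + 1)"
      unfolding f_def using b by (intro divide_right_mono) auto
    then show ?thesis by (simp add: power_add field_simps)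
  qed
  then have "x - real (digit_prefix b d n) / real b ^ n \<le> 1 / real b ^ n"
    using tail geo by (rule sums_le)
  then have "x \<le> (real (digit_prefix b d n) + 1) / real b ^ n"
    by (simp add: add_divide_distrib)
  moreover have "real b ^ n > 0" using b by simp
  ultimately have "real (digit_prefix b d n) < real b ^ n * x"
    "real b ^ n * x \<le> real (digit_prefix b d n) + 1"
    using pos by (simp_all add: pos_le_divide_eq pos_divide_less_eq mult.commute)
  then have "\<lceil>real b ^ n * x\<rceil> = int (digit_prefix b d n) + 1"
    by (intro ceiling_unique) auto
  then show ?thesis by simp
qed

lemma ex_nonterminating_expansion:
  assumes b: "b \<ge> 2" and x: "0 < x" "x \<le> 1"
  shows "\<exists>d. is_nonterminating_expansion b x d"
proof -
  define c where "c = (\<lambda>n. \<lceil>real b ^ n * x\<rceil> - 1)"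
  define d where "d = (\<lambda>n. nat (c (Suc n) - int b * c n))"
  have lo: "real_of_int (c n) < real b ^ n * x"
    and hi: "real b ^ n * x \<le> real_of_int (c n) + 1" for n
    unfolding c_def by linarith+
  have c_lower: "int b * c n \<le> c (Suc n)" for n
  proof -
    have "real_of_int (int b * c n) < real b ^ Suc n * x"
      using mult_strict_left_mono[OF lo[of n], of "real b"] b by (simp add: mult.assoc)
    then have "int b * c n < \<lceil>real b ^ Suc n * x\<rceil>" by (simp only: less_ceiling_iff)
    then show ?thesis unfolding c_def by linarith
  qed
  have c_upper: "c (Suc n) < int b * c n + int b" for n
  proof -
    have "real b ^ Suc n * x \<le> real_of_int (int b * c n + int b)"
      using mult_left_mono[OF hi[of n], of "real b"] b by (simp add: algebra_simps)
    then have "real_of_int (c (Suc n)) < real_of_int (int b * c n + int b)"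
      using lo[of "Suc n"] by linarith
    then show ?thesis by (simp only: of_int_less_iff)
  qed
  have c0: "c 0 = 0" using x unfolding c_def by (simp add: ceiling_unique)
  have pre: "int (digit_prefix b d n) = c n" for n
  proof (induction n)
    case 0 show ?case by (simp add: c0)
  next
    case (Suc n)
    have "int (d n) = c (Suc n) - int b * c n" unfolding d_def using c_lower[of n] by simp
    with Suc show ?case by simp
  qed
  have part: "(\<Sum>i<n. real (d i) / real b ^ (i + 1)) = real_of_int (c n) / real b ^ n" for n
    using sum_digits_eq_prefix[OF b, of d n] pre[of n] by (metis of_int_of_nat_eq)
  have dlt: "d n < b" for n
    unfolding d_def using c_lower[of n] c_upper[of n] by linarith
  have "(\<lambda>n. x - (1 / real b) ^ n) \<longlonglongrightarrow> x - 0"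
    using b by (intro tendsto_intros LIMSEQ_power_zero) auto
  then have L: "(\<lambda>n. x - (1 / real b) ^ n) \<longlonglongrightarrow> x" by simp
  have bp: "real b ^ n > 0" for n using b by simp
  have "(\<lambda>n. real_of_int (c n) / real b ^ n) \<longlonglongrightarrow> x"
  proof (rule tendsto_sandwich[OF _ _ L tendsto_const])
    show "\<forall>\<^sub>F n in sequentially. x - (1 / real b) ^ n \<le> real_of_int (c n) / real b ^ n"
    proof (intro always_eventually allI)
      fix n
      have "x \<le> (real_of_int (c n) + 1) / real b ^ n"
        using hi[of n] bp[of n] by (simp add: pos_le_divide_eq mult.commute)
      then show "x - (1 / real b) ^ n \<le> real_of_int (c n) / real b ^ n"
        by (simp add: add_divide_distrib power_one_over)
    qed
    show "\<forall>\<^sub>F n in sequentially. real_of_int (c n) / real b ^ n \<le> x"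
      using lo bp by (intro always_eventually allI)
        (simp add: pos_divide_le_eq mult.commute less_imp_le)
  qed
  then have sm: "(\<lambda>i. real (d i) / real b ^ (i + 1)) sums x"
    unfolding sums_def by (simp only: part)
  have "infinite {i. d i \<noteq> 0}"
  proof
    assume "finite {i. d i \<noteq> 0}"
    then obtain N where N: "\<And>i. i \<ge> N \<Longrightarrow> d i = 0"
      by (metis (mono_tags, lifting) finite_nat_set_iff_bounded leD mem_Collect_eq)
    have "(\<lambda>i. real (d i) / real b ^ (i + 1)) sums (\<Sum>i<N. real (d i) / real b ^ (i + 1))"
      by (rule sums_finite) (auto simp: N)
    then have "x = real_of_int (c N) / real b ^ N"
      using sm sums_unique2 part by metis
    then show False using lo[of N] b by simp
  qed
  then show ?thesis using dlt sm by (auto simp: is_nonterminating_expansion_def)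
qed

lemma ex1_nonterminating_expansion:
  assumes b: "b \<ge> 2" and x: "0 < x" "x \<le> 1"
  shows "\<exists>!d. is_nonterminating_expansion b x d"
proof (rule ex_ex1I[OF ex_nonterminating_expansion[OF assms]])
  fix d e assume "is_nonterminating_expansion b x d" "is_nonterminating_expansion b x e"
  then have eq: "digit_prefix b d n = digit_prefix b e n" for n
    using digit_prefix_eq_ceiling[OF b] by (metis of_nat_eq_iff)
  show "d = e"
  proof
    fix n show "d n = e n" using eq[of n] eq[of "Suc n"] by simp
  qed
qed

lemma is_nonterminating_expansion_digits:
  assumes "b \<ge> 2" "0 < x" "x \<le> 1"
  shows "is_nonterminating_expansion b x (digits b x)"
  unfolding digits_def by (rule theI'[OF ex1_nonterminating_expansion[OF assms]])

end

theory Submission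
  imports Defs "HOL-Real_Asymp.Real_Asymp"
begin

text \<open>
  Any pair of finite words can be prolonged so as to force either behaviour. Prolonging both words
  by a long common block of zeros makes \<open>S\<^sub>n\<close> comparable to \<open>n\<close>; prolonging one word of length
  \<open>m\<close> by zeros and the other one by ones keeps \<open>S\<^sub>n \<le> m\<close>, because the last letters of a longer
  common substring would be \<open>0\<close> and \<open>1\<close>. Hence, for each \<open>N\<close>, the pairs whose ratio
  \<open>S\<^sub>n / log\<^sub>b n\<close> is at least \<open>N\<close> (at most \<open>1 / (N + 1)\<close>) for some \<open>n \<ge> N\<close> contain a dense
  open set. The intersection of these countably many sets lies in \<open>S(0, \<infinity>)\<close>, and \<open>S(\<alpha>)\<close>
  is disjoint from \<open>S(0, \<infinity>)\<close>.
\<close>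

section \<open>Nowhere dense and first category sets\<close>

lemma nowhere_dense_in_subset:
  assumes "nowhere_dense_in X A" "B \<subseteq> A"
  shows "nowhere_dense_in X B"
  using assms interior_of_mono[OF closure_of_mono[OF assms(2)], of X X]
  unfolding nowhere_dense_in_def by blast

text \<open>An open set missing \<open>A\<close> also misses the closure of \<open>A\<close>.
  Applied with \<open>W\<close> the interior of that closure, the hypothesis would give a nonempty
  open subset of the closure disjoint from it.\<close>

lemma nowhere_dense_inI:
  assumes "A \<subseteq> topspace X"
    and "\<And>W. openin X W \<Longrightarrow> W \<noteq> {} \<Longrightarrow> \<exists>V. openin X V \<and> V \<noteq> {} \<and> V \<subseteq> W \<and> V \<inter> A = {}"
  shows "nowhere_dense_in X A"
proof -
  let ?W = "X interior_of (X closure_of A)"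
  have "?W = {}"
  proof (rule ccontr)
    assume "?W \<noteq> {}"
    then obtain V where V: "openin X V" "V \<noteq> {}" "V \<subseteq> ?W" "V \<inter> A = {}"
      using assms(2)[OF openin_interior_of] by meson
    then have "V \<inter> X closure_of A = {}"
      using openin_Int_closure_of_eq_empty[OF V(1)] by simp
    moreover have "V \<subseteq> X closure_of A" using V(3) interior_of_subset by (rule order_trans)
    ultimately show False using V(2) by (simp add: Int_absorb2)
  qed
  then show ?thesis using assms(1) by (simp add: nowhere_dense_in_def)
qed

lemma first_category_in_subset:
  assumes "first_category_in X A" "B \<subseteq> A"
  shows "first_category_in X B"
proof -
  obtain \<F> where \<F>: "countable \<F>" "\<forall>N\<in>\<F>. nowhere_dense_in X N" "A = \<Union>\<F>"
    using assms(1) by (auto simp: first_category_in_def)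
  \<comment> \<open>\<open>first_category_in\<close> demands equality with the union, so every
    member of the cover is cut down to \<open>B\<close>.\<close>
  have "countable ((\<lambda>N. N \<inter> B) ` \<F>)" using \<F>(1) by simp
  moreover have "\<forall>N\<in>(\<lambda>N. N \<inter> B) ` \<F>. nowhere_dense_in X N"
    using \<F>(2) by (auto intro: nowhere_dense_in_subset)
  moreover have "B = \<Union>((\<lambda>N. N \<inter> B) ` \<F>)" using \<F>(3) assms(2) by blast
  ultimately show ?thesis unfolding first_category_in_def by blast
qed

section \<open>Digit cylinders and the topology of the unit square\<close>

lemma digit_prefix_cong:
  "(\<And>i. i < n \<Longrightarrow> c i = d i) \<Longrightarrow> digit_prefix b c n = digit_prefix b d n"
  by (induction n) auto

lemma digit_prefix_less:
  assumes "\<And>i. c i < b"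
  shows "digit_prefix b c n < b ^ n"
proof (induction n)
  case (Suc n)
  have "b * digit_prefix b c n + c n < b * digit_prefix b c n + b" using assms by simp
  also have "\<dots> = b * Suc (digit_prefix b c n)" by simp
  also have "\<dots> \<le> b * b ^ n" using Suc by (intro mult_le_mono) auto
  finally show ?case by simp
qed simp

text \<open>The last digit is the remainder of the prefix modulo \<open>b\<close>, and the shorter
  prefix is the quotient.\<close>

lemma digit_prefix_eqD:
  assumes "\<And>i. c i < b" "\<And>i. d i < b" "digit_prefix b c n = digit_prefix b d n" "i < n"
  shows "c i = d i"
  using assms(3,4)
proof (induction n)
  case (Suc n)
  have e: "b * digit_prefix b c n + c n = b * digit_prefix b d n + d n" using Suc.prems by simp
  have "c n = d n" using arg_cong[OF e, of "\<lambda>k. k mod b"] assms(1,2) by simp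
  moreover have "digit_prefix b c n = digit_prefix b d n"
    using arg_cong[OF e, of "\<lambda>k. k div b"] assms(1,2)[of n] by simp
  ultimately show ?case using Suc by (cases "i = n") auto
qed simp

lemma digits_less:
  assumes "b \<ge> 2" "0 < x" "x \<le> 1"
  shows "digits b x i < b"
  using is_nonterminating_expansion_digits[OF assms] by (simp add: is_nonterminating_expansion_def)

text \<open>By the ceiling formula for prefixes, the cylinder of the first \<open>k\<close> digits
  of \<open>c\<close> is the interval from \<open>P / b^k\<close> (excluded) to
  \<open>(P + 1) / b^k\<close> (included). Its interior serves as \<open>I\<close>.\<close>

lemma digit_cylinder_contains_open:
  fixes b :: nat
  assumes b: "b \<ge> 2" and c: "\<And>i. c i < b"
  shows "\<exists>I. open I \<and> I \<noteq> {} \<and> I \<subseteq> {0<..1::real} \<and> (\<forall>z\<in>I. \<forall>i<k. digits b z i = c i)"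
proof -
  define P where "P = real (digit_prefix b c k)"
  define I where "I = {P / real b ^ k <..< (P + 1) / real b ^ k}"
  have bp: "real b ^ k > 0" using b by simp
  \<comment> \<open>This bound keeps the right endpoint of \<open>I\<close> at most 1.\<close>
  have "Suc (digit_prefix b c k) \<le> b ^ k" using digit_prefix_less[of c b k] c by simp
  then have "real (Suc (digit_prefix b c k)) \<le> real (b ^ k)" by (simp only: of_nat_le_iff)
  then have P1: "P + 1 \<le> real b ^ k" by (simp add: P_def)
  have sub: "I \<subseteq> {0<..1}"
  proof
    fix z assume z: "z \<in> I"
    have "0 \<le> P / real b ^ k" by (simp add: P_def)
    moreover have "(P + 1) / real b ^ k \<le> 1" using P1 bp by simp
    ultimately show "z \<in> {0<..1}" using z by (auto simp: I_def)
  qed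
  have "digits b z i = c i" if z: "z \<in> I" and i: "i < k" for z i
  proof -
    have z01: "0 < z" "z \<le> 1" using sub z by auto
    have "P < real b ^ k * z" "real b ^ k * z < P + 1"
      using z bp by (auto simp: I_def pos_divide_less_eq pos_less_divide_eq mult.commute)
    then have "\<lceil>real b ^ k * z\<rceil> = int (digit_prefix b c k) + 1"
      by (intro ceiling_unique) (auto simp: P_def)
    then have "digit_prefix b (digits b z) k = digit_prefix b c k"
      using digit_prefix_eq_ceiling[OF b is_nonterminating_expansion_digits[OF b z01], of k] by simp
    from digit_prefix_eqD[OF _ c this i] digits_less[OF b z01] show ?thesis by blast
  qed
  moreover have "I \<noteq> {}" using divide_strict_right_mono[OF _ bp, of P "P + 1"] by (simp add: I_def)
  moreover have "open I" by (simp add: I_def)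
  ultimately show ?thesis using sub by blast
qed

text \<open>A common prefix of length \<open>m\<close> gives \<open>b^m x\<close> and
  \<open>b^m z\<close> the same ceiling, so they differ by at most 1.\<close>

lemma dist_le_if_digits_agree:
  fixes b :: nat
  assumes b: "b \<ge> 2" and x: "0 < x" "x \<le> 1" and z: "0 < z" "z \<le> 1"
    and eq: "\<And>i. i < m \<Longrightarrow> digits b x i = digits b z i"
  shows "dist x z \<le> (1 / real b) ^ m"
proof -
  have "digit_prefix b (digits b x) m = digit_prefix b (digits b z) m"
    by (rule digit_prefix_cong) (rule eq)
  then have "\<lceil>real b ^ m * x\<rceil> = \<lceil>real b ^ m * z\<rceil>"
    using digit_prefix_eq_ceiling[OF b is_nonterminating_expansion_digits[OF b x], of m]
      digit_prefix_eq_ceiling[OF b is_nonterminating_expansion_digits[OF b z], of m] by simp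
  then have "\<bar>real b ^ m * x - real b ^ m * z\<bar> \<le> 1" by linarith
  then have "real b ^ m * \<bar>x - z\<bar> \<le> 1"
    using b by (simp add: abs_mult flip: right_diff_distrib)
  then show ?thesis using b by (simp add: dist_real_def field_simps)
qed

text \<open>Reduces the topology to words: only the first \<open>m\<close> letters of
  \<open>d\<close> and \<open>e\<close> matter, and they must extend to words of length
  \<open>k\<close> that force membership in \<open>G\<close>. Products of open intervals inside the
  extended cylinders then meet every open set and lie in \<open>G\<close>.\<close>

lemma nowhere_dense_in_if_prefixes_extend:
  fixes b :: nat and G :: "(real \<times> real) set"
  defines "T \<equiv> {0<..1} \<times> {0<..1}"
  assumes b: "b \<ge> 2"
    and ext: "\<And>m d e. (\<And>i. d i < b) \<Longrightarrow> (\<And>i. e i < b) \<Longrightarrow> \<exists>c c' k. m \<le> k \<and>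
      (\<forall>i. c i < b) \<and> (\<forall>i. c' i < b) \<and> (\<forall>i<m. c i = d i \<and> c' i = e i) \<and>
      (\<forall>x y. (\<forall>i<k. digits b x i = c i \<and> digits b y i = c' i) \<longrightarrow> (x, y) \<in> G)"
  shows "nowhere_dense_in (top_of_set T) (T - G)"
proof (rule nowhere_dense_inI)
  fix W assume "openin (top_of_set T) W" "W \<noteq> {}"
  then obtain U x y where U: "open U" "W = T \<inter> U" and xyW: "(x, y) \<in> W"
    by (auto simp: openin_open)
  then obtain \<epsilon> where \<epsilon>: "\<epsilon> > 0" "ball (x, y) \<epsilon> \<subseteq> U"
    by (metis Int_iff open_contains_ball)
  have x: "0 < x" "x \<le> 1" and y: "0 < y" "y \<le> 1" using xyW U by (auto simp: T_def)
  \<comment> \<open>Each coordinate may move by less than \<open>\<epsilon> / 2\<close>, because the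
    distance in the plane is at most the sum of the coordinate distances.\<close>
  obtain m where m: "(1 / real b) ^ m < \<epsilon> / 2"
    using real_arch_pow_inv[of "\<epsilon> / 2" "1 / real b"] \<epsilon>(1) b by fastforce
  obtain c c' k where k: "m \<le> k" and c: "\<And>i. c i < b" "\<And>i. c' i < b"
    and agree: "\<And>i. i < m \<Longrightarrow> c i = digits b x i \<and> c' i = digits b y i"
    and G: "\<And>x y. (\<forall>i<k. digits b x i = c i \<and> digits b y i = c' i) \<Longrightarrow> (x, y) \<in> G"
    using ext[of "digits b x" "digits b y" m, OF digits_less[OF b x] digits_less[OF b y]] by blast
  obtain I where I: "open I" "I \<noteq> {}" "I \<subseteq> {0<..1}" "\<And>z i. z \<in> I \<Longrightarrow> i < k \<Longrightarrow> digits b z i = c i"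
    using digit_cylinder_contains_open[of b c k, OF b c(1)] by blast
  obtain J where J: "open J" "J \<noteq> {}" "J \<subseteq> {0<..1}" "\<And>z i. z \<in> J \<Longrightarrow> i < k \<Longrightarrow> digits b z i = c' i"
    using digit_cylinder_contains_open[of b c' k, OF b c(2)] by blast
  have sub: "I \<times> J \<subseteq> T" using I(3) J(3) by (auto simp: T_def)
  have "I \<times> J \<subseteq> U"
  proof
    fix p assume "p \<in> I \<times> J"
    then obtain z w where p: "p = (z, w)" and zw: "z \<in> I" "w \<in> J" by auto
    have "dist x z \<le> (1 / real b) ^ m"
      using zw I k agree by (intro dist_le_if_digits_agree[OF b x]) auto
    moreover have "dist y w \<le> (1 / real b) ^ m"
      using zw J k agree by (intro dist_le_if_digits_agree[OF b y]) auto
    moreover have "dist (x, y) (z, w) \<le> dist x z + dist y w"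
      by (simp add: dist_Pair_Pair sqrt_sum_squares_le_sum)
    ultimately show "p \<in> U" using m \<epsilon>(2) p by (auto simp: subset_iff)
  qed
  then have "I \<times> J \<subseteq> W" using sub U by blast
  moreover have "openin (top_of_set T) (I \<times> J)"
    using I(1) J(1) sub by (simp add: open_Times openin_open_eq open_subset)
  moreover have "I \<times> J \<inter> (T - G) = {}" using G I(4) J(4) by auto
  ultimately show "\<exists>V. openin (top_of_set T) V \<and> V \<noteq> {} \<and> V \<subseteq> W \<and> V \<inter> (T - G) = {}"
    using I(2) J(2) by (intro exI[of _ "I \<times> J"]) auto
qed auto

section \<open>Extending words to force a large or a small ratio\<close>

lemma longest_common_substring_ge:
  assumes "i + l \<le> n" "j + l \<le> n" "\<And>k. k < l \<Longrightarrow> digits b x (i + k) = digits b y (j + k)"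
  shows "l \<le> longest_common_substring b n x y"
proof (cases "l = 0")
  case False
  then have "l \<in> common_substring_lengths b n x y"
    using assms by (auto simp: common_substring_lengths_def)
  then show ?thesis
    using Max_ge[OF finite_common_substring_lengths] by (auto simp: longest_common_substring_def)
qed simp

lemma longest_common_substring_le:
  assumes "\<And>l. l \<in> common_substring_lengths b n x y \<Longrightarrow> l \<le> m"
  shows "longest_common_substring b n x y \<le> m"
  using assms finite_common_substring_lengths by (auto simp: longest_common_substring_def)

text \<open>At \<open>n = 0\<close> and \<open>n = 1\<close> the logarithm is 0, hence so is the
  ratio; limits are not affected.\<close>

definition lcs_ratio :: "nat \<Rightarrow> real \<Rightarrow> real \<Rightarrow> nat \<Rightarrow> real" where
  "lcs_ratio b x y n = real (longest_common_substring b n x y) / log (real b) (real n)"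

lemma log_nat_nonneg: "b \<ge> 2 \<Longrightarrow> 0 \<le> log (real b) (real n)"
  by (cases "n = 0") (auto simp: log_def)

text \<open>Both words are continued by \<open>L\<close> zeros, so that the block starting at
  position \<open>m\<close> is common.\<close>

lemma nowhere_dense_lcs_ratio_small:
  fixes b N :: nat
  assumes b: "b \<ge> 2"
  shows "nowhere_dense_in (top_of_set ({0<..1} \<times> {0<..1}))
    ({0<..1} \<times> {0<..1} - {(x, y). \<exists>n\<ge>N. real N \<le> lcs_ratio b x y n})"
proof (rule nowhere_dense_in_if_prefixes_extend[OF b])
  fix m and d e :: "nat \<Rightarrow> nat"
  assume de: "\<And>i. d i < b" "\<And>i. e i < b"
  have lb: "ln (real b) > 0" using b by simp
  \<comment> \<open>The quotient is \<open>L / log b (m + L)\<close>, which is unbounded in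
    \<open>L\<close> for fixed \<open>m\<close>. The later demand \<open>N \<le> L\<close> makes
    \<open>n = m + L\<close> at least \<open>N\<close>.\<close>
  have "filterlim (\<lambda>L. real L * ln (real b) / ln (real m + real L)) at_top sequentially"
    using lb by real_asymp
  then have "\<forall>\<^sub>F L in sequentially. real N \<le> real L * ln (real b) / ln (real m + real L)"
    by (auto simp: filterlim_at_top)
  then have "\<forall>\<^sub>F L in sequentially. real N \<le> real L * ln (real b) / ln (real m + real L) \<and> N \<le> L"
    using eventually_ge_at_top eventually_conj by blast
  then obtain L where L: "real N \<le> real L * ln (real b) / ln (real m + real L)" "N \<le> L"
    using eventually_happens' sequentially_bot by blast
  have "real N \<le> lcs_ratio b x y (m + L)"
    if "\<And>i. i < m + L \<Longrightarrow> digits b x i = (if i < m then d i else 0) \<and>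
      digits b y i = (if i < m then e i else 0)" for x y
  proof -
    have "real L \<le> real (longest_common_substring b (m + L) x y)"
      using that by (simp add: longest_common_substring_ge[where i=m and j=m])
    then have "real L / log (real b) (real (m + L)) \<le> lcs_ratio b x y (m + L)"
      unfolding lcs_ratio_def by (intro divide_right_mono log_nat_nonneg[OF b])
    then show ?thesis using L(1) by (simp add: log_def)
  qed
  then show "\<exists>c c' k. m \<le> k \<and> (\<forall>i. c i < b) \<and> (\<forall>i. c' i < b) \<and>
      (\<forall>i<m. c i = d i \<and> c' i = e i) \<and>
      (\<forall>x y. (\<forall>i<k. digits b x i = c i \<and> digits b y i = c' i) \<longrightarrow>
        (x, y) \<in> {(x, y). \<exists>n\<ge>N. real N \<le> lcs_ratio b x y n})"
    using de b L(2)
    by (intro exI[of _ "\<lambda>i. if i < m then d i else 0"] exI[of _ "\<lambda>i. if i < m then e i else 0"]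
        exI[of _ "m + L"]) (auto intro!: exI[of _ "m + L"])
qed

text \<open>One word is continued by zeros and the other by ones, both being letters since
  \<open>b \<ge> 2\<close>. The bound \<open>m\<close> on the common length is independent of
  \<open>L\<close>.\<close>

lemma nowhere_dense_lcs_ratio_large:
  fixes b N :: nat
  assumes b: "b \<ge> 2"
  shows "nowhere_dense_in (top_of_set ({0<..1} \<times> {0<..1}))
    ({0<..1} \<times> {0<..1} - {(x, y). \<exists>n\<ge>N. lcs_ratio b x y n \<le> 1 / real (Suc N)})"
proof (rule nowhere_dense_in_if_prefixes_extend[OF b])
  fix m and d e :: "nat \<Rightarrow> nat"
  assume de: "\<And>i. d i < b" "\<And>i. e i < b"
  have lb: "ln (real b) > 0" using b by simp
  \<comment> \<open>For fixed \<open>m\<close> the bound \<open>m / log b (m + L)\<close> vanishes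
    as \<open>L\<close> grows.\<close>
  have "((\<lambda>L. real m * ln (real b) / ln (real m + real L)) \<longlongrightarrow> 0) sequentially"
    by real_asymp
  then have "\<forall>\<^sub>F L in sequentially. real m * ln (real b) / ln (real m + real L) < 1 / real (Suc N)"
    by (rule order_tendstoD) simp
  then have "\<forall>\<^sub>F L in sequentially. real m * ln (real b) / ln (real m + real L) < 1 / real (Suc N) \<and> N \<le> L"
    using eventually_ge_at_top eventually_conj by blast
  then obtain L where L: "real m * ln (real b) / ln (real m + real L) < 1 / real (Suc N)" "N \<le> L"
    using eventually_happens' sequentially_bot by blast
  have "lcs_ratio b x y (m + L) \<le> 1 / real (Suc N)"
    if xy: "\<And>i. i < m + L \<Longrightarrow> digits b x i = (if i < m then d i else 0) \<and>
      digits b y i = (if i < m then e i else 1)" for x y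
  proof -
    have "longest_common_substring b (m + L) x y \<le> m"
    proof (rule longest_common_substring_le, rule ccontr)
      fix l assume "l \<in> common_substring_lengths b (m + L) x y" and l: "\<not> l \<le> m"
      then obtain i j where ij: "i + l \<le> m + L" "j + l \<le> m + L"
        "\<forall>k<l. digits b x (i + k) = digits b y (j + k)"
        by (auto simp: common_substring_lengths_def)
      \<comment> \<open>The last letters of the two blocks are compared: as \<open>l > m\<close>,
        both stand at positions from \<open>m\<close> up to \<open>m + L - 1\<close>, where the
        digits are 0 and 1.\<close>
      moreover have "l - 1 < l" using l by simp
      ultimately have "digits b x (i + (l - 1)) = digits b y (j + (l - 1))" by blast
      moreover have "i + (l - 1) < m + L" "\<not> i + (l - 1) < m"
        "j + (l - 1) < m + L" "\<not> j + (l - 1) < m" using ij l by linarith+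
      then have "digits b x (i + (l - 1)) = 0" "digits b y (j + (l - 1)) = 1"
        using xy by simp_all
      ultimately show False by simp
    qed
    then have "lcs_ratio b x y (m + L) \<le> real m / log (real b) (real (m + L))"
      unfolding lcs_ratio_def by (intro divide_right_mono log_nat_nonneg[OF b]) simp
    then show ?thesis using L(1) by (simp add: log_def)
  qed
  then show "\<exists>c c' k. m \<le> k \<and> (\<forall>i. c i < b) \<and> (\<forall>i. c' i < b) \<and>
      (\<forall>i<m. c i = d i \<and> c' i = e i) \<and>
      (\<forall>x y. (\<forall>i<k. digits b x i = c i \<and> digits b y i = c' i) \<longrightarrow>
        (x, y) \<in> {(x, y). \<exists>n\<ge>N. lcs_ratio b x y n \<le> 1 / real (Suc N)})"
    using de b L(2)
    by (intro exI[of _ "\<lambda>i. if i < m then d i else 0"] exI[of _ "\<lambda>i. if i < m then e i else 1"]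
        exI[of _ "m + L"]) (auto intro!: exI[of _ "m + L"])
qed

section \<open>From frequent extreme values to liminf and limsup\<close>

lemma liminf_eq_0_if_frequently_small:
  fixes r :: "nat \<Rightarrow> real"
  assumes nonneg: "\<And>n. 0 \<le> r n" and small: "\<And>N. \<exists>n\<ge>N. r n \<le> 1 / real (Suc N)"
  shows "liminf (\<lambda>n. ereal (r n)) = 0"
proof (rule antisym)
  show "0 \<le> liminf (\<lambda>n. ereal (r n))"
    using nonneg by (intro Liminf_bounded always_eventually) simp
  have "(INF n\<in>{N..}. ereal (r n)) \<le> ereal \<epsilon>" if \<epsilon>: "\<epsilon> > 0" for N \<epsilon>
  proof -
    \<comment> \<open>\<open>K\<close> measures the smallness and \<open>N\<close> the tail; the
      index \<open>max N K\<close> meets both demands at once.\<close>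
    obtain K where K: "1 / real (Suc K) < \<epsilon>" using nat_approx_posE[OF \<epsilon>] by blast
    obtain n where n: "n \<ge> max N K" "r n \<le> 1 / real (Suc (max N K))" using small[of "max N K"] by blast
    have "1 / real (Suc (max N K)) \<le> 1 / real (Suc K)" by (intro divide_left_mono) auto
    then have "r n \<le> \<epsilon>" using n K by linarith
    then show ?thesis using n by (intro INF_lower2[of n]) auto
  qed
  then have "liminf (\<lambda>n. ereal (r n)) \<le> ereal \<epsilon>" if "\<epsilon> > 0" for \<epsilon>
    unfolding liminf_SUP_INF using that by (intro SUP_least)
  then show "liminf (\<lambda>n. ereal (r n)) \<le> 0"
    by - (rule ereal_le_epsilon2, simp)
qed

lemma limsup_eq_infinity_if_frequently_large:
  fixes r :: "nat \<Rightarrow> real"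
  assumes large: "\<And>N. \<exists>n\<ge>N. real N \<le> r n"
  shows "limsup (\<lambda>n. ereal (r n)) = \<infinity>"
proof (rule ereal_top)
  fix B
  have "ereal B \<le> (SUP n\<in>{N..}. ereal (r n))" for N
  proof -
    obtain K where K: "B \<le> real K" using real_arch_simple by blast
    obtain n where n: "n \<ge> max N K" "real (max N K) \<le> r n" using large[of "max N K"] by blast
    then have "B \<le> r n" using K by linarith
    then show ?thesis using n by (intro SUP_upper2[of n]) auto
  qed
  then show "ereal B \<le> limsup (\<lambda>n. ereal (r n))"
    unfolding limsup_INF_SUP by (intro INF_greatest)
qed

section \<open>Assembling the countable cover of the exceptional pairs\<close>

theorem theorem1p2:
  fixes b :: nat
  assumes "b \<ge> 2"
  shows
    "(\<forall>\<alpha>::real. 0 < \<alpha> \<longrightarrow>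
        first_category_in (top_of_set ({0<..1} \<times> {0<..1}))
          {(x, y) \<in> {0<..1::real} \<times> {0<..1::real}.
             (\<lambda>n. real (longest_common_substring b n x y) / log (real b) (real n))
               \<longlonglongrightarrow> \<alpha>}) \<and>
     residual_in (top_of_set ({0<..1} \<times> {0<..1}))
       {(x, y) \<in> {0<..1::real} \<times> {0<..1::real}.
          liminf (\<lambda>n. ereal (real (longest_common_substring b n x y) / log (real b) (real n))) = 0 \<and>
          limsup (\<lambda>n. ereal (real (longest_common_substring b n x y) / log (real b) (real n))) = \<infinity>}"
proof -
  let ?T = "{0<..1::real} \<times> {0<..1::real}"
  let ?E = "{(x, y) \<in> ?T. liminf (\<lambda>n. ereal (lcs_ratio b x y n)) = 0 \<and>
    limsup (\<lambda>n. ereal (lcs_ratio b x y n)) = \<infinity>}"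
  \<comment> \<open>\<open>A N\<close> and \<open>B N\<close> collect the pairs that fail the
    \<open>N\<close>-th largeness and smallness condition.\<close>
  define A where "A N = ?T - {(x, y). \<exists>n\<ge>N. real N \<le> lcs_ratio b x y n}" for N
  define B where "B N = ?T - {(x, y). \<exists>n\<ge>N. lcs_ratio b x y n \<le> 1 / real (Suc N)}" for N
  have "first_category_in (top_of_set ?T) (\<Union>(range A \<union> range B))"
    unfolding first_category_in_def
  proof (intro exI conjI)
    show "countable (range A \<union> range B)" by simp
    show "\<forall>N\<in>range A \<union> range B. nowhere_dense_in (top_of_set ?T) N"
      using nowhere_dense_lcs_ratio_small[OF assms] nowhere_dense_lcs_ratio_large[OF assms]
      by (auto simp: A_def B_def)
  qed simp
  \<comment> \<open>A pair outside all these sets satisfies every condition, which forces liminf 0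
    and limsup \<open>\<infinity>\<close>.\<close>
  moreover have "?T - ?E \<subseteq> \<Union>(range A \<union> range B)"
  proof (rule subsetI, rule ccontr)
    fix p assume p: "p \<in> ?T - ?E" and nAB: "p \<notin> \<Union>(range A \<union> range B)"
    obtain x y where xy: "p = (x, y)" by fastforce
    have "\<exists>n\<ge>N. real N \<le> lcs_ratio b x y n" for N using nAB p xy by (auto simp: A_def)
    moreover have "\<exists>n\<ge>N. lcs_ratio b x y n \<le> 1 / real (Suc N)" for N
      using nAB p xy by (auto simp: B_def)
    moreover have "0 \<le> lcs_ratio b x y n" for n
      unfolding lcs_ratio_def by (intro divide_nonneg_nonneg log_nat_nonneg[OF assms]) simp
    ultimately have "p \<in> ?E"
      using p xy liminf_eq_0_if_frequently_small limsup_eq_infinity_if_frequently_large by auto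
    then show False using p by blast
  qed
  ultimately have co: "first_category_in (top_of_set ?T) (?T - ?E)"
    by (rule first_category_in_subset)
  have "first_category_in (top_of_set ?T) {(x, y) \<in> ?T. lcs_ratio b x y \<longlonglongrightarrow> \<alpha>}"
    if "0 < \<alpha>" for \<alpha>
  proof (rule first_category_in_subset[OF co])
    \<comment> \<open>A limit \<open>\<alpha> > 0\<close> is also the liminf, which is then not 0,
      so such a pair lies outside \<open>?E\<close>.\<close>
    have "liminf (\<lambda>n. ereal (lcs_ratio b x y n)) \<noteq> 0" if "lcs_ratio b x y \<longlonglongrightarrow> \<alpha>" for x y
    proof -
      have "liminf (\<lambda>n. ereal (lcs_ratio b x y n)) = ereal \<alpha>"
        using that by (intro lim_imp_Liminf) auto
      then show ?thesis using \<open>0 < \<alpha>\<close> by simp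
    qed
    then show "{(x, y) \<in> ?T. lcs_ratio b x y \<longlonglongrightarrow> \<alpha>} \<subseteq> ?T - ?E" by blast
  qed
  moreover have "residual_in (top_of_set ?T) ?E"
    using co by (auto simp: residual_in_def)
  ultimately show ?thesis by (simp add: lcs_ratio_def[abs_def])
qed

end
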